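(* Let $(U,p)$ be a partial metric space. If the topological space $(U,\mathcal{T}[p])$ is compact, then it is sequentially compact.
   Context: Let $\mathbb{R}_+=[0,\infty)$. A partial metric on a nonempty set $U$ is a function $p:U\times U\to\mathbb{R}_+$ such that for all $x,y,z\in U$: (1) $x=y \Leftrightarrow p(x,x)=p(x,y)=p(y,y)$; (2) $p(x,x)\le p(y,x)$; (3) $p(x,y)=p(y,x)$; (4) $p(x,y)\le p(x,z)+p(z,y)-p(z,z)$. The pair $(U,p)$ is called a partial metric space. For $x\in U$ and $\varepsilon>0$ the open ball is $B(x,\varepsilon)=\{y\in U: p(x,y)<p(x,x)+\varepsilon\}$; the open balls form a basis of a topology on $U$ denoted $\mathcal{T}[p]$. A sequence $(x_n)$ converges to $x$ in $(U,p)$ if $\lim_{n\to\infty}p(x_n,x)=p(x,x)$ (this is equivalent to convergence in $\mathcal{T}[p]$). A topological space is compact if every open cover has a finite subcover (no separation axiom is assumed). It is sequentially compact if every sequence of its elements has a convergent subsequence. Topological properties of $(U,p)$ refer to $(U,\mathcal{T}[p])$. *)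

theory Defs
  imports "HOL-Analysis.Analysis"
begin

text \<open>No separation axiom is assumed and sequences may have several limits.\<close>

definition seq_compact_space :: "'a topology \<Rightarrow> bool" where
  "seq_compact_space X \<longleftrightarrow>
    (\<forall>s :: nat \<Rightarrow> 'a. range s \<subseteq> topspace X \<longrightarrow>
      (\<exists>l r. strict_mono (r :: nat \<Rightarrow> nat) \<and> limitin X (s \<circ> r) l sequentially))"

text \<open>As for \<open>Metric_space\<close> in the library, the space is a carrier set rather than a whole type;
  values of \<open>p\<close> outside the carrier are irrelevant.\<close>

locale partial_metric_space =
  fixes U :: "'a set" and p :: "'a \<Rightarrow> 'a \<Rightarrow> real"
  assumes nonempty: "U \<noteq> {}"
    and nonneg: "\<lbrakk>x \<in> U; y \<in> U\<rbrakk> \<Longrightarrow> 0 \<le> p x y"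
    and indist: "\<lbrakk>x \<in> U; y \<in> U\<rbrakk> \<Longrightarrow> x = y \<longleftrightarrow> p x x = p x y \<and> p x y = p y y"
    and self_le: "\<lbrakk>x \<in> U; y \<in> U\<rbrakk> \<Longrightarrow> p x x \<le> p y x"
    and commute: "\<lbrakk>x \<in> U; y \<in> U\<rbrakk> \<Longrightarrow> p x y = p y x"
    and triangle: "\<lbrakk>x \<in> U; y \<in> U; z \<in> U\<rbrakk> \<Longrightarrow> p x y \<le> p x z + p z y - p z z"
begin

definition pball :: "'a \<Rightarrow> real \<Rightarrow> 'a set" where
  "pball x \<epsilon> = {y \<in> U. p x y < p x x + \<epsilon>}"

definition ptopology :: "'a topology" where
  "ptopology = topology (arbitrary union_of (\<lambda>V. \<exists>x\<in>U. \<exists>\<epsilon>>0. V = pball x \<epsilon>))"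

lemma centre_in_pball: "\<lbrakk>x \<in> U; 0 < \<epsilon>\<rbrakk> \<Longrightarrow> x \<in> pball x \<epsilon>"
  by (simp add: pball_def)

lemma pball_nested:
  assumes "x \<in> U" "y \<in> pball x \<epsilon>"
  shows "\<exists>\<delta>>0. pball y \<delta> \<subseteq> pball x \<epsilon>"
proof (intro exI conjI)
  show "0 < \<epsilon> + p x x - p x y"
    using assms by (simp add: pball_def)
  show "pball y (\<epsilon> + p x x - p x y) \<subseteq> pball x \<epsilon>"
  proof
    fix z assume "z \<in> pball y (\<epsilon> + p x x - p x y)"
    then show "z \<in> pball x \<epsilon>"
      using assms triangle[of x z y] by (auto simp: pball_def)
  qed
qed

lemma union_of_pballs_iff:
  "(arbitrary union_of (\<lambda>V. \<exists>x\<in>U. \<exists>\<epsilon>>0. V = pball x \<epsilon>)) S \<longleftrightarrow>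
    S \<subseteq> U \<and> (\<forall>x\<in>S. \<exists>\<epsilon>>0. pball x \<epsilon> \<subseteq> S)" (is "?L \<longleftrightarrow> ?R")
proof
  assume ?L
  then obtain \<B> where \<B>: "\<And>V. V \<in> \<B> \<Longrightarrow> \<exists>x\<in>U. \<exists>\<epsilon>>0. V = pball x \<epsilon>" and S: "S = \<Union>\<B>"
    unfolding union_of_def by auto
  have "S \<subseteq> U"
    using \<B> unfolding S pball_def by blast
  moreover have "\<exists>\<epsilon>>0. pball y \<epsilon> \<subseteq> S" if "y \<in> S" for y
  proof -
    from that S obtain V where V: "V \<in> \<B>" "y \<in> V" by blast
    with \<B> obtain x \<epsilon> where "x \<in> U" "V = pball x \<epsilon>" by blast
    with pball_nested[of x y \<epsilon>] V obtain \<delta> where "\<delta> > 0" "pball y \<delta> \<subseteq> V" by blast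
    then show ?thesis using V S by blast
  qed
  ultimately show ?R
    by blast
next
  assume R: ?R
  show ?L
    unfolding arbitrary_union_of_alt
  proof
    fix x assume "x \<in> S"
    with R obtain \<epsilon> where "\<epsilon> > 0" "pball x \<epsilon> \<subseteq> S" "x \<in> U"
      by blast
    then show "\<exists>V. (\<exists>x\<in>U. \<exists>\<epsilon>>0. V = pball x \<epsilon>) \<and> x \<in> V \<and> V \<subseteq> S"
      using centre_in_pball by blast
  qed
qed

text \<open>The function \<open>topology\<close> is only meaningful on families closed under finite intersections
  and unions; the next lemma shows that this is the case here.\<close>

lemma openin_ptopology:
  "openin ptopology S \<longleftrightarrow> S \<subseteq> U \<and> (\<forall>x\<in>S. \<exists>\<epsilon>>0. pball x \<epsilon> \<subseteq> S)"
proof -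
  have inter: "\<exists>\<epsilon>>0. pball x \<epsilon> \<subseteq> S \<inter> T"
    if "0 < a" "pball x a \<subseteq> S" "0 < b" "pball x b \<subseteq> T" for x a b S T
  proof (intro exI conjI)
    show "0 < min a b" using that by simp
    show "pball x (min a b) \<subseteq> S \<inter> T" using that by (auto simp: pball_def)
  qed
  have "istopology (\<lambda>S. S \<subseteq> U \<and> (\<forall>x\<in>S. \<exists>\<epsilon>>0. pball x \<epsilon> \<subseteq> S))"
    unfolding istopology_def
  proof (intro conjI allI impI)
    fix S T
    assume "S \<subseteq> U \<and> (\<forall>x\<in>S. \<exists>\<epsilon>>0. pball x \<epsilon> \<subseteq> S)"
       and "T \<subseteq> U \<and> (\<forall>x\<in>T. \<exists>\<epsilon>>0. pball x \<epsilon> \<subseteq> T)"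
    then show "S \<inter> T \<subseteq> U" "\<forall>x\<in>S \<inter> T. \<exists>\<epsilon>>0. pball x \<epsilon> \<subseteq> S \<inter> T"
      using inter by blast+
  next
    fix \<K> assume K: "\<forall>K\<in>\<K>. K \<subseteq> U \<and> (\<forall>x\<in>K. \<exists>\<epsilon>>0. pball x \<epsilon> \<subseteq> K)"
    show "\<Union>\<K> \<subseteq> U" using K by blast
    show "\<forall>x\<in>\<Union>\<K>. \<exists>\<epsilon>>0. pball x \<epsilon> \<subseteq> \<Union>\<K>"
    proof
      fix x assume "x \<in> \<Union>\<K>"
      then obtain K where "K \<in> \<K>" "x \<in> K" by blast
      with K obtain \<epsilon> where "\<epsilon> > 0" "pball x \<epsilon> \<subseteq> K" by blast
      with \<open>K \<in> \<K>\<close> show "\<exists>\<epsilon>>0. pball x \<epsilon> \<subseteq> \<Union>\<K>" by blast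
    qed
  qed
  moreover have "(arbitrary union_of (\<lambda>V. \<exists>x\<in>U. \<exists>\<epsilon>>0. V = pball x \<epsilon>)) =
      (\<lambda>S. S \<subseteq> U \<and> (\<forall>x\<in>S. \<exists>\<epsilon>>0. pball x \<epsilon> \<subseteq> S))"
    by (intro ext union_of_pballs_iff)
  ultimately show ?thesis
    by (simp add: ptopology_def)
qed

lemma openin_pball: "x \<in> U \<Longrightarrow> openin ptopology (pball x \<epsilon>)"
  unfolding openin_ptopology using pball_nested by (auto simp: pball_def)

lemma topspace_ptopology: "topspace ptopology = U"
proof
  show "topspace ptopology \<subseteq> U"
    using openin_ptopology openin_topspace by blast
  have "openin ptopology U"
    unfolding openin_ptopology by (auto simp: pball_def intro: exI[of _ 1])
  then show "U \<subseteq> topspace ptopology"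
    by (rule openin_subset)
qed

text \<open>Topological convergence agrees with convergence of the partial distances.\<close>

lemma limitin_ptopology:
  assumes "range s \<subseteq> U" "x \<in> U"
  shows "limitin ptopology s x sequentially \<longleftrightarrow> (\<lambda>n. p (s n) x) \<longlonglongrightarrow> p x x"
proof
  assume L: "limitin ptopology s x sequentially"
  show "(\<lambda>n. p (s n) x) \<longlonglongrightarrow> p x x"
  proof (rule tendstoI)
    fix e :: real assume "0 < e"
    then have "\<forall>\<^sub>F n in sequentially. s n \<in> pball x e"
      using L openin_pball centre_in_pball assms by (auto simp: limitin_def)
    then show "\<forall>\<^sub>F n in sequentially. dist (p (s n) x) (p x x) < e"
    proof eventually_elim
      case (elim n)
      then have "s n \<in> U" "p x (s n) < p x x + e"
        by (auto simp: pball_def)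
      then show ?case
        using self_le[of x "s n"] commute[of x "s n"] assms by (auto simp: dist_real_def)
    qed
  qed
next
  assume L: "(\<lambda>n. p (s n) x) \<longlonglongrightarrow> p x x"
  show "limitin ptopology s x sequentially"
    unfolding limitin_def
  proof (intro conjI allI impI)
    show "x \<in> topspace ptopology" using assms by (simp add: topspace_ptopology)
    fix V assume "openin ptopology V \<and> x \<in> V"
    then obtain e where e: "0 < e" "pball x e \<subseteq> V"
      by (auto simp: openin_ptopology)
    from L \<open>0 < e\<close> have "\<forall>\<^sub>F n in sequentially. p (s n) x < p x x + e"
      by (intro order_tendstoD) auto
    then show "\<forall>\<^sub>F n in sequentially. s n \<in> V"
    proof eventually_elim
      case (elim n)
      have "s n \<in> U" using assms by auto
      then have "s n \<in> pball x e"
        using elim commute[of x "s n"] assms by (simp add: pball_def)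
      then show ?case using e by blast
    qed
  qed
qed

end

end

theory Submission
  imports Defs
begin

text \<open>The triangle inequality makes the balls of radius \<open>1 / (n + 1)\<close> a countable neighbourhood base
  at their centre, so the topology of a partial metric is first countable. In a compact space every
  sequence has a cluster point (lemma \<open>compact_space_sequence_cluster_point\<close>): otherwise each point
  would have a neighbourhood that the sequence visits only finitely often, and finitely many of
  these would cover the space. In a first countable space, a cluster point is the limit of some
  subsequence (lemma \<open>cluster_point_imp_limitin_subsequence\<close>): one picks increasing indices whose
  terms enter a decreasing countable base.\<close>

text \<open>Each point that is not a cluster point has an open neighbourhood containing the terms of only
  finitely many indices. A finite cover by such sets would leave only finitely many indices.\<close>

lemma compact_space_sequence_cluster_point:
  fixes s :: "nat \<Rightarrow> 'a"
  assumes "compact_space X" "range s \<subseteq> topspace X"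
  obtains x where "x \<in> topspace X" "\<And>V. \<lbrakk>openin X V; x \<in> V\<rbrakk> \<Longrightarrow> infinite {n. s n \<in> V}"
proof (rule ccontr)
  assume "\<not> thesis"
  with that have "\<forall>x \<in> topspace X. \<exists>V. openin X V \<and> x \<in> V \<and> finite {n. s n \<in> V}"
    by blast
  then have cover: "topspace X \<subseteq> \<Union>{V. openin X V \<and> finite {n. s n \<in> V}}"
    by blast
  obtain \<F> where \<F>: "finite \<F>" "\<F> \<subseteq> {V. openin X V \<and> finite {n. s n \<in> V}}" "topspace X \<subseteq> \<Union>\<F>"
    using compactinD[OF assms(1)[unfolded compact_space_def] _ cover] by auto
  have "n \<in> (\<Union>V\<in>\<F>. {n. s n \<in> V})" for n
  proof -
    have "s n \<in> \<Union>\<F>"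
      using \<F>(3) assms(2) rangeI[of s n] by (meson subsetD)
    then show ?thesis
      by simp
  qed
  then have "(\<Union>V\<in>\<F>. {n. s n \<in> V}) = UNIV"
    by blast
  moreover have "finite (\<Union>V\<in>\<F>. {n. s n \<in> V})"
    using \<F>(1,2) by (intro finite_UN_I) auto
  ultimately show False
    by simp
qed

text \<open>A countable base at a point need not be nested; the intersections of the initial segments of
  an enumeration of it are.\<close>

lemma first_countable_decreasing_base:
  assumes "first_countable X" "x \<in> topspace X"
  obtains W :: "nat \<Rightarrow> 'a set"
    where "\<And>n. openin X (W n)" "\<And>n. x \<in> W n" "decseq W"
      "\<And>V. \<lbrakk>openin X V; x \<in> V\<rbrakk> \<Longrightarrow> \<exists>n. W n \<subseteq> V"
proof -
  obtain \<B> where \<B>: "countable \<B>" "\<And>V. V \<in> \<B> \<Longrightarrow> openin X V"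
      "\<And>V. \<lbrakk>openin X V; x \<in> V\<rbrakk> \<Longrightarrow> \<exists>B\<in>\<B>. x \<in> B \<and> B \<subseteq> V"
    using assms unfolding first_countable_def by metis
  define \<C> where "\<C> = {B \<in> \<B>. x \<in> B}"
  have \<C>: "countable \<C>" "\<C> \<noteq> {}"
    using \<B>(1) \<B>(3)[OF openin_topspace assms(2)] by (auto simp: \<C>_def)
  define W where "W = (\<lambda>n. \<Inter>i\<le>n. from_nat_into \<C> i)"
  have in\<C>: "from_nat_into \<C> i \<in> \<C>" for i
    by (rule from_nat_into[OF \<C>(2)])
  show thesis
  proof
    show "openin X (W n)" for n
      unfolding W_def using in\<C> \<B>(2) by (intro openin_INT2) (auto simp: \<C>_def)
    show "x \<in> W n" for n
      using in\<C> by (auto simp: W_def \<C>_def)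
    show "decseq W"
      by (force simp: W_def decseq_def)
    fix V assume "openin X V" "x \<in> V"
    then obtain B where "B \<in> \<C>" "B \<subseteq> V"
      using \<B>(3) by (auto simp: \<C>_def)
    then obtain n where "from_nat_into \<C> n \<subseteq> V"
      by (metis \<C>(1) from_nat_into_surj)
    then have "W n \<subseteq> V"
      unfolding W_def by blast
    then show "\<exists>n. W n \<subseteq> V" ..
  qed
qed

text \<open>Every set of a decreasing base contains terms with arbitrarily large index, so the indices of
  the subsequence can be chosen one after the other. Because the base is decreasing, entering one
  of its sets is enough for all later chosen terms to stay inside it.\<close>

lemma cluster_point_imp_limitin_subsequence:
  fixes s :: "nat \<Rightarrow> 'a"
  assumes "first_countable X" "x \<in> topspace X"
    and cluster: "\<And>V. \<lbrakk>openin X V; x \<in> V\<rbrakk> \<Longrightarrow> infinite {n. s n \<in> V}"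
  obtains r :: "nat \<Rightarrow> nat" where "strict_mono r" "limitin X (s \<circ> r) x sequentially"
proof -
  obtain W where W: "\<And>n. openin X (W n)" "\<And>n. x \<in> W n" "decseq W"
      "\<And>V. \<lbrakk>openin X V; x \<in> V\<rbrakk> \<Longrightarrow> \<exists>n. W n \<subseteq> V"
    using first_countable_decreasing_base[OF assms(1,2)] by blast
  have later: "\<exists>j>k. s j \<in> W n" for k n
    using cluster[OF W(1,2)] by (auto simp: infinite_nat_iff_unbounded)
  have "\<exists>r. \<forall>n. s (r n) \<in> W n \<and> r n < r (Suc n)"
    using dependent_nat_choice[of "\<lambda>n k. s k \<in> W n" "\<lambda>_ k j. k < j"] later by blast
  then obtain r where r: "\<And>n. s (r n) \<in> W n" "\<And>n. r n < r (Suc n)"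
    by blast
  show thesis
  proof
    show "strict_mono r"
      using r(2) by (simp add: strict_mono_Suc_iff)
    show "limitin X (s \<circ> r) x sequentially"
      unfolding limitin_sequentially
    proof (intro conjI allI impI)
      fix V assume "openin X V \<and> x \<in> V"
      then obtain N where "W N \<subseteq> V"
        using W(4) by blast
      have "(s \<circ> r) n \<in> V" if "n \<ge> N" for n
        using r(1)[of n] decseqD[OF W(3) that] \<open>W N \<subseteq> V\<close> by auto
      then show "\<exists>N. \<forall>n\<ge>N. (s \<circ> r) n \<in> V"
        by blast
    qed (fact assms(2))
  qed
qed

lemma compact_first_countable_imp_seq_compact_space:
  assumes "compact_space X" "first_countable X"
  shows "seq_compact_space X"
  unfolding seq_compact_space_def
proof (intro allI impI)
  fix s :: "nat \<Rightarrow> 'a" assume "range s \<subseteq> topspace X"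
  with assms(1) obtain x where x: "x \<in> topspace X"
      "\<And>V. \<lbrakk>openin X V; x \<in> V\<rbrakk> \<Longrightarrow> infinite {n. s n \<in> V}"
    by (rule compact_space_sequence_cluster_point) blast
  then obtain r where "strict_mono r" "limitin X (s \<circ> r) x sequentially"
    using cluster_point_imp_limitin_subsequence[OF assms(2) x] by blast
  then show "\<exists>l r. strict_mono r \<and> limitin X (s \<circ> r) l sequentially"
    by blast
qed

lemma (in partial_metric_space) first_countable_ptopology: "first_countable ptopology"
  unfolding first_countable_def
proof
  fix x assume "x \<in> topspace ptopology"
  then have x: "x \<in> U"
    by (simp add: topspace_ptopology)
  let ?\<B> = "range (\<lambda>n. pball x (inverse (real (Suc n))))"
  have "\<exists>V\<in>?\<B>. x \<in> V \<and> V \<subseteq> S" if S: "openin ptopology S" "x \<in> S" for S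
  proof -
    obtain \<epsilon> where "\<epsilon> > 0" "pball x \<epsilon> \<subseteq> S"
      using S by (auto simp: openin_ptopology)
    moreover obtain n where "inverse (real (Suc n)) < \<epsilon>"
      using reals_Archimedean[OF \<open>\<epsilon> > 0\<close>] by blast
    then have "pball x (inverse (real (Suc n))) \<subseteq> pball x \<epsilon>"
      by (auto simp: pball_def)
    moreover have "x \<in> pball x (inverse (real (Suc n)))"
      using x by (intro centre_in_pball) auto
    ultimately show ?thesis
      by (intro rev_bexI[OF rangeI, of _ _ n]) auto
  qed
  moreover have "countable ?\<B>" "\<forall>V\<in>?\<B>. openin ptopology V"
    using openin_pball[OF x] by auto
  ultimately show "\<exists>\<B>. countable \<B> \<and> (\<forall>V\<in>\<B>. openin ptopology V) \<and>
      (\<forall>S. openin ptopology S \<and> x \<in> S \<longrightarrow> (\<exists>V\<in>\<B>. x \<in> V \<and> V \<subseteq> S))"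
    by (intro exI[of _ ?\<B>]) simp
qed

theorem theorem4p3:
  fixes U :: "'a set" and p :: "'a \<Rightarrow> 'a \<Rightarrow> real"
  assumes "partial_metric_space U p"
    and "compact_space (partial_metric_space.ptopology U p)"
  shows "seq_compact_space (partial_metric_space.ptopology U p)"
  using compact_first_countable_imp_seq_compact_space[OF assms(2)]
    partial_metric_space.first_countable_ptopology[OF assms(1)] .

end
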